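(* (i) Let $n \in \mathbb{N}$ with $n > 2$, let $F$ be any field with at least $4n-2$ elements, and let $A \in \mathbb{M}_n(F)$ be a nonscalar matrix. Then there exists an invertible matrix $P \in \mathbb{M}_n(F)$ such that the entries of the matrix $P^{-1}AP$ are all nonzero and its diagonal entries are mutually distinct. (ii) Let $F$ be a field with at least $6$ elements and let $A \in \mathbb{M}_2(F)$ be a nonscalar matrix. Then there exists an invertible matrix $P \in \mathbb{M}_2(F)$ such that the entries of the matrix $P^{-1}AP$ are all nonzero. Moreover, if the characteristic of $F$ is not $2$, then $P$ can be chosen so that, in addition, the diagonal entries of $P^{-1}AP$ are mutually distinct.
   Context: $\mathbb{M}_n(F)$ denotes the algebra of $n\times n$ matrices over $F$. A matrix is nonscalar if it is not of the form $\lambda I$ with $\lambda \in F$. Fields may be finite or infinite. *)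

theory Defs
  imports "Jordan_Normal_Form.Gauss_Jordan_Elimination"
begin

definition nonscalar_mat :: "'a::semiring_1 mat \<Rightarrow> bool" where
  "nonscalar_mat A \<longleftrightarrow> \<not> (\<exists>c. A = c \<cdot>\<^sub>m 1\<^sub>m (dim_row A))"

text \<open>\<^const>\<open>mat_inverse\<close> is option-valued; the lemma \<open>mat_inv_correct\<close> below shows that on
  invertible matrices the following is the inverse.\<close>

definition mat_inv :: "'a::field mat \<Rightarrow> 'a mat" where
  "mat_inv P = the (mat_inverse P)"

definition nonzero_entries :: "'a::zero mat \<Rightarrow> bool" where
  "nonzero_entries B \<longleftrightarrow> (\<forall>i<dim_row B. \<forall>j<dim_col B. B $$ (i, j) \<noteq> 0)"

text \<open>\<^const>\<open>card\<close> is 0 on infinite sets, so infinite fields need their own disjunct.\<close>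

definition at_least_elements :: "'a itself \<Rightarrow> nat \<Rightarrow> bool" where
  "at_least_elements _ k \<longleftrightarrow> infinite (UNIV :: 'a set) \<or> k \<le> card (UNIV :: 'a set)"

lemma mat_inv_correct:
  fixes P :: "'a::field mat"
  assumes P: "P \<in> carrier_mat n n" and "invertible_mat P"
  shows "mat_inv P \<in> carrier_mat n n" "P * mat_inv P = 1\<^sub>m n" "mat_inv P * P = 1\<^sub>m n"
proof -
  from assms obtain Q where PQ: "P * Q = 1\<^sub>m n" and QP: "Q * P = 1\<^sub>m (dim_row Q)"
    by (auto simp: invertible_mat_def inverts_mat_def)
  have "dim_col (P * Q) = n" "dim_col (Q * P) = dim_row Q"
    by (simp_all only: PQ QP index_one_mat)
  then have Q: "Q \<in> carrier_mat n n" using P by auto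
  with P PQ QP have "P \<in> Units (ring_mat TYPE('a) n ())"
    unfolding Units_def by (auto simp: ring_mat_def)
  then obtain B where B: "mat_inverse P = Some B"
    using mat_inverse(1)[OF P, of "()"] by (cases "mat_inverse P") auto
  show "mat_inv P \<in> carrier_mat n n" "P * mat_inv P = 1\<^sub>m n" "mat_inv P * P = 1\<^sub>m n"
    using mat_inverse(2)[OF P B] B by (auto simp: mat_inv_def)
qed

end

theory Submission
  imports Defs "Jordan_Normal_Form.Column_Operations" "HOL-Computational_Algebra.Polynomial"
begin

text \<open>Consider the conditions \<open>a\<^sub>k\<^sub>l \<noteq> 0\<close> and \<open>a\<^sub>k\<^sub>k \<noteq> a\<^sub>l\<^sub>l\<close> (\<open>k < l\<close>) on a matrix. Conjugation by
  a transvection \<open>1 + t E\<^sub>i\<^sub>j\<close> turns each of them into the non-vanishing of a polynomial in \<open>t\<close>, and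
  the degrees of these polynomials sum up to at most \<open>2n + (2n - 3) = 4n - 3\<close>. Hence some \<open>t\<close>
  satisfies every condition whose polynomial is not identically zero, in particular every one
  that already holds at \<open>t = 0\<close>. So if \<open>B\<close> satisfies a maximal number of conditions within the
  similarity class of \<open>A\<close>, the polynomials of all violated conditions are identically zero, for all
  \<open>i \<noteq> j\<close>. Reading off their coefficients, a zero off-diagonal entry spreads until \<open>B\<close> is scalar;
  and once all off-diagonal entries are nonzero, no other condition can be violated, apart from
  \<open>a\<^sub>0\<^sub>0 \<noteq> a\<^sub>1\<^sub>1\<close> when \<open>n = 2\<close> and the characteristic is \<open>2\<close>.\<close>

text \<open>The product of the nonzero \<open>p c\<close> is a nonzero polynomial of degree below
  \<open>m\<close>, so its roots cannot exhaust a field that is infinite or has at least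
  \<open>m\<close> elements.\<close>

lemma exists_common_nonroot:
  fixes p :: "'b \<Rightarrow> 'a::field poly"
  assumes "finite C" and deg: "(\<Sum>c\<in>C. degree (p c)) < m"
    and F: "at_least_elements TYPE('a) m"
  shows "\<exists>t. \<forall>c\<in>C. p c \<noteq> 0 \<longrightarrow> poly (p c) t \<noteq> 0"
proof -
  let ?D = "{c\<in>C. p c \<noteq> 0}"
  define q where "q = prod p ?D"
  have fin: "finite ?D" using assms(1) by simp
  have q0: "q \<noteq> 0" unfolding q_def using fin by simp
  have "degree q \<le> (\<Sum>c\<in>?D. degree (p c))"
    unfolding q_def using degree_prod_sum_le[OF fin, of p] by (simp add: o_def)
  also have "\<dots> \<le> (\<Sum>c\<in>C. degree (p c))"
    by (rule sum_mono2) (use assms(1) in auto)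
  finally have less: "degree q < m" using deg by simp
  have "{t. poly q t = 0} \<noteq> UNIV"
  proof
    assume "{t. poly q t = 0} = UNIV"
    then have "finite (UNIV :: 'a set)" "card (UNIV :: 'a set) \<le> degree q"
      using poly_roots_finite[OF q0] card_poly_roots_bound[OF q0] by simp_all
    then show False using F less by (simp add: at_least_elements_def)
  qed
  then obtain t where "poly q t \<noteq> 0" by auto
  then have "\<forall>c\<in>C. p c \<noteq> 0 \<longrightarrow> poly (p c) t \<noteq> 0"
    using fin by (auto simp: q_def poly_prod)
  then show ?thesis by blast
qed

section \<open>Conditions as polynomials in the transvection parameter\<close>

text \<open>Only labels: \<open>Inl\<close> stands for a nonzero entry (diagonal ones included),
  \<open>Inr\<close> for two distinct diagonal entries. Requiring \<open>k < l\<close> counts each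
  unordered pair once, which keeps the degree sum small.\<close>

definition conditions :: "nat \<Rightarrow> (nat \<times> nat + nat \<times> nat) set" where
  "conditions n = ({..<n} \<times> {..<n}) <+> {(k, l). k < l \<and> l < n}"

text \<open>The condition labelled \<open>c\<close> holds exactly when this value is
  nonzero.\<close>

fun condition :: "'a::ring_1 mat \<Rightarrow> nat \<times> nat + nat \<times> nat \<Rightarrow> 'a" where
  "condition A (Inl (k, l)) = A $$ (k, l)"
| "condition A (Inr (k, l)) = A $$ (k, k) - A $$ (l, l)"

text \<open>For \<open>i \<noteq> j\<close>, this is the \<open>(k, l)\<close> entry of
  \<open>(1 - t E\<^sub>i\<^sub>j) A (1 + t E\<^sub>i\<^sub>j)\<close> as a polynomial in
  \<open>t\<close>: column \<open>i\<close> is added to column \<open>j\<close>, and row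
  \<open>j\<close> is subtracted from row \<open>i\<close>. Only position \<open>(i, j)\<close>
  feels both operations and gets a quadratic term.\<close>

definition entry_poly :: "'a::comm_ring_1 mat \<Rightarrow> nat \<Rightarrow> nat \<Rightarrow> nat \<Rightarrow> nat \<Rightarrow> 'a poly" where
  "entry_poly A i j k l = [:A $$ (k, l),
     (if l = j then A $$ (k, i) else 0) - (if k = i then A $$ (j, l) else 0),
     if k = i \<and> l = j then - A $$ (j, i) else 0:]"

fun condition_poly :: "'a::comm_ring_1 mat \<Rightarrow> nat \<Rightarrow> nat \<Rightarrow> nat \<times> nat + nat \<times> nat \<Rightarrow> 'a poly" where
  "condition_poly A i j (Inl (k, l)) = entry_poly A i j k l"
| "condition_poly A i j (Inr (k, l)) = entry_poly A i j k k - entry_poly A i j l l"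

lemma finite_conditions: "finite (conditions n)"
proof -
  have "{(k, l). k < l \<and> l < n} \<subseteq> {..<n} \<times> {..<n}" by auto
  then have "finite {(k, l). k < l \<and> l < n}" by (rule finite_subset) simp
  then show ?thesis by (simp add: conditions_def)
qed

lemma poly_entry_poly:
  assumes "A \<in> carrier_mat n n" "i < n" "j < n" "i \<noteq> j" "k < n" "l < n"
  shows "poly (entry_poly A i j k l) t = add_col_sub_row t i j A $$ (k, l)"
  using assms by (auto simp: entry_poly_def algebra_simps)

lemma poly_condition_poly:
  assumes "A \<in> carrier_mat n n" "i < n" "j < n" "i \<noteq> j" "c \<in> conditions n"
  shows "poly (condition_poly A i j c) t = condition (add_col_sub_row t i j A) c"
  using assms(5) by (auto simp: conditions_def poly_entry_poly[OF assms(1-4)])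

lemma poly_condition_poly_0: "poly (condition_poly A i j c) 0 = condition A c"
  by (cases "(A, c)" rule: condition.cases) (auto simp: entry_poly_def)

lemma degree_entry_poly: "degree (entry_poly A i j k l) \<le> of_bool (k = i) + of_bool (l = j)"
  by (auto simp: entry_poly_def)

text \<open>A diagonal position never equals \<open>(i, j)\<close>, so diagonal entries are at most
  linear in \<open>t\<close>, and constant if their index is neither \<open>i\<close> nor
  \<open>j\<close>.\<close>

lemma degree_condition_poly_Inr:
  assumes "i \<noteq> j"
  shows "degree (condition_poly A i j (Inr (k, l))) \<le> of_bool ({k, l} \<inter> {i, j} \<noteq> {})"
proof -
  have "degree (entry_poly A i j m m) \<le> of_bool ({k, l} \<inter> {i, j} \<noteq> {})" if "m \<in> {k, l}" for m
  proof (rule order_trans[OF degree_entry_poly])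
    show "of_bool (m = i) + of_bool (m = j) \<le> (of_bool ({k, l} \<inter> {i, j} \<noteq> {}) :: nat)"
      using assms that by (cases "m = i"; cases "m = j") auto
  qed
  then show ?thesis by (simp add: degree_diff_le)
qed

text \<open>There are \<open>n - 1\<close> pairs containing \<open>i\<close>, and
  \<open>n - 2\<close> further ones containing \<open>j\<close> but not \<open>i\<close>;
  \<open>min\<close> and \<open>max\<close> put each pair in increasing order.\<close>

lemma card_pairs_meeting:
  fixes i j n :: nat
  assumes "i < n" "j < n" "i \<noteq> j"
  shows "card {(k, l). k < l \<and> l < n \<and> {k, l} \<inter> {i, j} \<noteq> {}} \<le> 2 * n - 3"
proof -
  let ?f = "\<lambda>a b. (min a b, max a b)"
  have "{(k, l). k < l \<and> l < n \<and> {k, l} \<inter> {i, j} \<noteq> {}}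
      \<subseteq> ?f i ` ({..<n} - {i}) \<union> ?f j ` ({..<n} - {i, j})" (is "?S \<subseteq> ?T \<union> ?U")
  proof
    fix x assume "x \<in> ?S"
    then obtain k l where x: "x = (k, l)" "k < l" "l < n" "k = i \<or> l = i \<or> k = j \<or> l = j" by auto
    consider "k = i" | "l = i" | "k = j" "l \<noteq> i" | "l = j" "k \<noteq> i" using x by blast
    then show "x \<in> ?T \<union> ?U"
    proof cases
      case 1 then show ?thesis using x by (intro UnI1 image_eqI[of _ _ l]) auto
    next
      case 2 then show ?thesis using x by (intro UnI1 image_eqI[of _ _ k]) auto
    next
      case 3 then show ?thesis using x by (intro UnI2 image_eqI[of _ _ l]) auto
    next
      case 4 then show ?thesis using x by (intro UnI2 image_eqI[of _ _ k]) auto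
    qed
  qed
  then have "card ?S \<le> card (?T \<union> ?U)" by (intro card_mono) auto
  also have "\<dots> \<le> card ?T + card ?U" by (rule card_Un_le)
  also have "\<dots> \<le> card ({..<n} - {i}) + card ({..<n} - {i, j})"
    by (intro add_mono card_image_le) auto
  also have "\<dots> = 2 * n - 3" using assms by (simp add: card_Diff_subset)
  finally show ?thesis .
qed

text \<open>Row \<open>i\<close> and column \<open>j\<close> contribute at most \<open>n\<close>
  each, position \<open>(i, j)\<close> being counted twice for its quadratic term; the diagonal
  differences add at most \<open>2 * n - 3\<close>.\<close>

lemma sum_degree_condition_poly:
  assumes "i < n" "j < n" "i \<noteq> j"
  shows "(\<Sum>c\<in>conditions n. degree (condition_poly A i j c)) < 4 * n - 2"
proof -
  let ?d = "\<lambda>c. degree (condition_poly A i j c)"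
  let ?P = "{(k, l). k < l \<and> l < n}"
  have finP: "finite ?P" by (rule finite_subset[of _ "{..<n} \<times> {..<n}"]) auto
  have "(\<Sum>c\<in>Inl ` ({..<n} \<times> {..<n}). ?d c)
      = (\<Sum>k<n. \<Sum>l<n. degree (entry_poly A i j k l))"
    by (subst sum.reindex) (auto simp: sum.cartesian_product o_def case_prod_unfold intro: sum.cong)
  also have "\<dots> \<le> (\<Sum>k<n. \<Sum>l<n. of_bool (k = i) + of_bool (l = j))"
    by (intro sum_mono degree_entry_poly)
  also have "\<dots> = 2 * n"
  proof -
    have "(\<Sum>k<n. of_bool (k = a)) = (1 :: nat)" if "a < n" for a
      using that by (simp add: of_bool_def)
    then show ?thesis using assms by (simp add: sum.distrib sum_Suc flip: sum_distrib_left)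
  qed
  finally have 1: "(\<Sum>c\<in>Inl ` ({..<n} \<times> {..<n}). ?d c) \<le> 2 * n" .
  have "(\<Sum>c\<in>Inr ` ?P. ?d c) = (\<Sum>x\<in>?P. ?d (Inr x))"
    by (subst sum.reindex) (auto simp: o_def)
  also have "\<dots> \<le> (\<Sum>x\<in>?P. of_bool ({fst x, snd x} \<inter> {i, j} \<noteq> {}))"
  proof (rule sum_mono)
    fix x :: "nat \<times> nat"
    show "?d (Inr x) \<le> of_bool ({fst x, snd x} \<inter> {i, j} \<noteq> {})"
      using degree_condition_poly_Inr[OF assms(3), of A "fst x" "snd x"] by simp
  qed
  also have "\<dots> = card {x\<in>?P. {fst x, snd x} \<inter> {i, j} \<noteq> {}}"
    using finP by (simp only: sum_of_bool_eq Int_def mem_Collect_eq of_nat_id)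
  also have "{x\<in>?P. {fst x, snd x} \<inter> {i, j} \<noteq> {}}
      = {(k, l). k < l \<and> l < n \<and> {k, l} \<inter> {i, j} \<noteq> {}}" by auto
  also have "card \<dots> \<le> 2 * n - 3" by (rule card_pairs_meeting[OF assms])
  finally have 2: "(\<Sum>c\<in>Inr ` ?P. ?d c) \<le> 2 * n - 3" .
  have "(\<Sum>c\<in>conditions n. ?d c) = (\<Sum>c\<in>Inl ` ({..<n} \<times> {..<n}). ?d c) + (\<Sum>c\<in>Inr ` ?P. ?d c)"
    unfolding conditions_def Plus_def using finP by (intro sum.union_disjoint) auto
  also have "\<dots> \<le> 2 * n + (2 * n - 3)" using 1 2 by (rule add_mono)
  \<comment> \<open>Distinct \<open>i\<close>, \<open>j\<close> below \<open>n\<close> force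
    \<open>n \<ge> 2\<close>, so the truncated subtractions are exact.\<close>
  also have "\<dots> < 4 * n - 2" using assms by linarith
  finally show ?thesis .
qed

section \<open>Maximal matrices in a similarity class\<close>

definition satisfied :: "nat \<Rightarrow> 'a::ring_1 mat \<Rightarrow> (nat \<times> nat + nat \<times> nat) set" where
  "satisfied n A = {c\<in>conditions n. condition A c \<noteq> 0}"

text \<open>The similarity class may be infinite, but the number of satisfied conditions is bounded
  by the number of all conditions, so a maximum is attained.\<close>

lemma exists_maximal_similar:
  fixes A :: "'a::field mat"
  assumes A: "A \<in> carrier_mat n n"
  shows "\<exists>B. (B \<in> carrier_mat n n \<and> similar_mat B A) \<and>
    (\<forall>C. C \<in> carrier_mat n n \<and> similar_mat C A \<longrightarrow> card (satisfied n C) \<le> card (satisfied n B))"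
proof -
  let ?P = "\<lambda>B. B \<in> carrier_mat n n \<and> similar_mat B A"
  have "?P A" using A similar_mat_refl by blast
  moreover have "card (satisfied n C) < Suc (card (conditions n))" for C :: "'a mat"
    by (simp add: less_Suc_eq_le satisfied_def card_mono finite_conditions)
  ultimately show ?thesis
    by (intro ex_has_greatest_nat[of ?P A _ "Suc (card (conditions n))"]) auto
qed

text \<open>Otherwise a common nonroot \<open>t\<close> would yield a similar matrix that satisfies
  \<open>c\<close> together with everything that \<open>B\<close> satisfies.\<close>

lemma condition_poly_eq_0_if_maximal:
  fixes A B :: "'a::field mat"
  assumes F: "at_least_elements TYPE('a) (4 * n - 2)"
    and B: "B \<in> carrier_mat n n" and sim: "similar_mat B A"
    and max: "\<forall>C. C \<in> carrier_mat n n \<and> similar_mat C A \<longrightarrow>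
      card (satisfied n C) \<le> card (satisfied n B)"
    and ij: "i < n" "j < n" "i \<noteq> j"
    and c: "c \<in> conditions n" "condition B c = 0"
  shows "condition_poly B i j c = 0"
proof (rule ccontr)
  assume nz: "condition_poly B i j c \<noteq> 0"
  obtain t where
    t: "\<And>d. d \<in> conditions n \<Longrightarrow> condition_poly B i j d \<noteq> 0 \<Longrightarrow> poly (condition_poly B i j d) t \<noteq> 0"
    using exists_common_nonroot[OF finite_conditions sum_degree_condition_poly[OF ij] F] by blast
  define C where "C = add_col_sub_row t i j B"
  have C: "C \<in> carrier_mat n n" "similar_mat C A"
    unfolding C_def using B similar_mat_trans[OF add_col_sub_row_similar[OF B ij] sim] by auto
  have good: "condition C d \<noteq> 0" if "d \<in> conditions n" "condition_poly B i j d \<noteq> 0" for d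
    using t[OF that] poly_condition_poly[OF B ij that(1)] by (simp add: C_def)
  have "satisfied n B \<subseteq> satisfied n C"
  proof
    fix d assume "d \<in> satisfied n B"
    then have d: "d \<in> conditions n" "condition B d \<noteq> 0" by (auto simp: satisfied_def)
    \<comment> \<open>At \<open>t = 0\<close> the transvection is the identity, so a condition
      satisfied by \<open>B\<close> has a nonzero polynomial.\<close>
    then have "condition_poly B i j d \<noteq> 0" using poly_condition_poly_0[of B i j d] by auto
    then show "d \<in> satisfied n C" using good d by (simp add: satisfied_def)
  qed
  moreover have "c \<in> satisfied n C - satisfied n B"
    using good[OF c(1) nz] c by (simp add: satisfied_def)
  ultimately have "satisfied n B \<subset> satisfied n C" by blast
  moreover have "finite (satisfied n C)" by (simp add: satisfied_def finite_conditions)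
  ultimately have "card (satisfied n B) < card (satisfied n C)" by (simp add: psubset_card_mono)
  then show False using max C by (meson not_le)
qed

text \<open>Scalar matrices commute with everything, so each is alone in its similarity
  class.\<close>

lemma nonscalar_mat_similar:
  fixes A B :: "'a::field mat"
  assumes "nonscalar_mat A" "similar_mat B A"
  shows "nonscalar_mat B"
  unfolding nonscalar_mat_def
proof
  assume "\<exists>c. B = c \<cdot>\<^sub>m 1\<^sub>m (dim_row B)"
  then obtain c where c: "B = c \<cdot>\<^sub>m 1\<^sub>m (dim_row B)" by blast
  obtain n P Q where *: "{A, B, P, Q} \<subseteq> carrier_mat n n" "P * Q = 1\<^sub>m n" "A = P * B * Q"
    using similar_matD[OF similar_mat_sym[OF assms(2)]] by auto
  have P: "P \<in> carrier_mat n n" "Q \<in> carrier_mat n n" and n: "dim_row B = n" "dim_row A = n"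
    using * by auto
  have "A = P * (c \<cdot>\<^sub>m 1\<^sub>m n) * Q" using * c n by simp
  also have "\<dots> = c \<cdot>\<^sub>m (P * Q)"
    using P by (simp add: mult_smult_distrib[of _ n n _ n] mult_smult_assoc_mat[of _ n n _ n])
  finally have "A = c \<cdot>\<^sub>m 1\<^sub>m (dim_row A)" using * n by simp
  then show False using assms(1) by (auto simp: nonscalar_mat_def)
qed

section \<open>A maximal matrix satisfies the conditions\<close>

lemma exists_similar_generic:
  fixes A :: "'a::field mat"
  assumes n: "n \<ge> 2" and F: "at_least_elements TYPE('a) (4 * n - 2)"
    and A: "A \<in> carrier_mat n n" "nonscalar_mat A"
  obtains B where "B \<in> carrier_mat n n" "similar_mat B A" "nonzero_entries B"
    "n > 2 \<or> CHAR('a) \<noteq> 2 \<Longrightarrow> distinct (diag_mat B)"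
proof -
  obtain B where B: "B \<in> carrier_mat n n" and sim: "similar_mat B A"
    and max: "\<forall>C. C \<in> carrier_mat n n \<and> similar_mat C A \<longrightarrow>
      card (satisfied n C) \<le> card (satisfied n B)"
    using exists_maximal_similar[OF A(1)] by (elim exE conjE)
  note zero = condition_poly_eq_0_if_maximal[OF F B sim max]
  have entry0: "entry_poly B i j k l = 0"
    if "i < n" "j < n" "i \<noteq> j" "k < n" "l < n" "B $$ (k, l) = 0" for i j k l
    using zero[of i j "Inl (k, l)"] that by (auto simp: conditions_def)
  \<comment> \<open>Taking \<open>(i, j) = (k, l)\<close>, the quadratic coefficient is
    \<open>- B $$ (l, k)\<close> and the linear one is the difference of the two diagonal
    entries.\<close>
  have mirror: "B $$ (l, k) = 0 \<and> B $$ (k, k) = B $$ (l, l)"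
    if "k < n" "l < n" "k \<noteq> l" "B $$ (k, l) = 0" for k l
    using entry0[of k l k l] that by (simp add: entry_poly_def)
  \<comment> \<open>Subtracting \<open>t\<close> times row \<open>m\<close> from row
    \<open>k\<close> gives the linear coefficient \<open>- B $$ (m, l)\<close>: a zero fills the
    off-diagonal part of its column.\<close>
  have spread: "B $$ (m, l) = 0"
    if "k < n" "l < n" "k \<noteq> l" "B $$ (k, l) = 0" "m < n" "m \<noteq> l" for k l m
    using entry0[of k m k l] that by (cases "m = k") (auto simp: entry_poly_def)
  have off: "B $$ (k, l) \<noteq> 0" if kl: "k < n" "l < n" "k \<noteq> l" for k l
  proof
    assume 0: "B $$ (k, l) = 0"
    have col: "B $$ (m, l) = 0" if "m < n" "m \<noteq> l" for m
      using spread[OF kl 0] that by blast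
    have row: "B $$ (l, m) = 0" "B $$ (m, m) = B $$ (l, l)" if "m < n" "m \<noteq> l" for m
      using mirror[OF that(1) kl(2) that(2) col[OF that]] by auto
    \<comment> \<open>Column \<open>l\<close> is already cleared by \<open>col\<close>; for
      \<open>b \<noteq> l\<close> the zero at \<open>(l, b)\<close> spreads through column
      \<open>b\<close>.\<close>
    have all: "B $$ (a, b) = 0" if "a < n" "b < n" "a \<noteq> b" for a b
      using spread[of l b a] row(1)[of b] col[of a] that kl by metis
    have "B = B $$ (l, l) \<cdot>\<^sub>m 1\<^sub>m (dim_row B)"
    proof (rule eq_matI)
      fix a b assume "a < dim_row (B $$ (l, l) \<cdot>\<^sub>m 1\<^sub>m (dim_row B))"
        "b < dim_col (B $$ (l, l) \<cdot>\<^sub>m 1\<^sub>m (dim_row B))"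
      then show "B $$ (a, b) = (B $$ (l, l) \<cdot>\<^sub>m 1\<^sub>m (dim_row B)) $$ (a, b)"
        using B all row(2)[of a] by (cases "a = l") auto
    qed (use B in auto)
    then show False using nonscalar_mat_similar[OF A(2) sim] by (auto simp: nonscalar_mat_def)
  qed
  have diag: "B $$ (k, k) \<noteq> 0" if k: "k < n" for k
  proof
    assume 0: "B $$ (k, k) = 0"
    have "(if k = 0 then 1 else 0) < n \<and> (if k = 0 then 1 else 0) \<noteq> k" using n by auto
    then obtain j where "j < n" "j \<noteq> k" by blast
    \<comment> \<open>The linear coefficient is \<open>- B $$ (j, k)\<close>, an off-diagonal
      entry.\<close>
    then show False using entry0[of k j k k] off[of j k] k 0 by (simp add: entry_poly_def)
  qed
  have "nonzero_entries B"
    unfolding nonzero_entries_def using off diag B by (metis carrier_matD)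
  moreover have "distinct (diag_mat B)" if big: "n > 2 \<or> CHAR('a) \<noteq> 2"
  proof -
    have ne: "B $$ (k, k) \<noteq> B $$ (l, l)" if kl: "k < l" "l < n" for k l
    proof
      assume eq: "B $$ (k, k) = B $$ (l, l)"
      have gap0: "entry_poly B i j k k = entry_poly B i j l l" if "i < n" "j < n" "i \<noteq> j" for i j
        using zero[OF that, of "Inr (k, l)"] kl eq by (auto simp: conditions_def)
      show False
      proof (cases "n > 2")
        case True
        have "card {k, l} < card {..<n}" using True kl by simp
        then have "\<not> {..<n} \<subseteq> {k, l}"
          by (metis card_mono finite.emptyI finite.insertI not_le)
        then obtain j where "j < n" "j \<noteq> k" "j \<noteq> l" by auto
        \<comment> \<open>With a third index \<open>j\<close>, the transvection changes the diagonal
          entry at \<open>k\<close> but not the one at \<open>l\<close>, so the linear coefficients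
          force \<open>B $$ (j, k) = 0\<close>.\<close>
        then show False using gap0[of k j] off[of j k] kl by (simp add: entry_poly_def)
      next
        case False
        \<comment> \<open>Without a third index, both diagonal entries move, by opposite multiples
          of \<open>B $$ (l, k)\<close>; only characteristic 2 allows these to agree.\<close>
        have "- B $$ (l, k) = B $$ (l, k)"
          using gap0[of k l] kl by (simp add: entry_poly_def)
        then have "B $$ (l, k) + B $$ (l, k) = 0" by (metis add.left_inverse)
        then have "of_nat 2 * B $$ (l, k) = 0" by (simp only: of_nat_numeral mult_2)
        then have "of_nat 2 = (0 :: 'a)" using off[of l k] kl by simp
        then have "CHAR('a) dvd 2" by (simp only: of_nat_eq_0_iff_char_dvd)
        then have "CHAR('a) = 1 \<or> CHAR('a) = 2"
          by (metis prime_nat_iff two_is_prime_nat)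
        then show False using False big by simp
      qed
    qed
    have "inj_on (\<lambda>k. B $$ (k, k)) {0..<n}"
      by (rule linorder_inj_onI) (auto dest: ne)
    then show ?thesis
      using B by (simp add: diag_mat_def distinct_map)
  qed
  ultimately show thesis using that B sim by blast
qed

section \<open>From similarity to conjugation by \<open>mat_inv\<close>\<close>

text \<open>Similarity supplies some two-sided inverse \<open>Q\<close> of \<open>P\<close>;
  uniqueness of inverses identifies it with \<open>mat_inv P\<close>.\<close>

lemma similar_mat_conjugate:
  fixes A B :: "'a::field mat"
  assumes "A \<in> carrier_mat n n" "similar_mat B A"
  shows "\<exists>P\<in>carrier_mat n n. invertible_mat P \<and> mat_inv P * A * P = B"
proof -
  obtain m Q P where *: "{B, A, Q, P} \<subseteq> carrier_mat m m" "Q * P = 1\<^sub>m m" "P * Q = 1\<^sub>m m" "B = Q * A * P"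
    using similar_matD[OF assms(2)] by blast
  have m: "m = n" using * assms(1) by auto
  have P: "P \<in> carrier_mat n n" and Q: "Q \<in> carrier_mat n n" using * m by auto
  have inv: "invertible_mat P"
    unfolding invertible_mat_def inverts_mat_def using * P Q m by auto
  have "mat_inv P = mat_inv P * (P * Q)"
    using mat_inv_correct(1)[OF P inv] * m by simp
  also have "\<dots> = mat_inv P * P * Q"
    using assoc_mult_mat[OF mat_inv_correct(1)[OF P inv] P Q] by simp
  also have "\<dots> = Q" using mat_inv_correct(3)[OF P inv] Q by simp
  finally show ?thesis using P inv * by blast
qed

lemma exists_conjugate_generic:
  fixes A :: "'a::field mat"
  assumes "n \<ge> 2" "at_least_elements TYPE('a) (4 * n - 2)"
    and A: "A \<in> carrier_mat n n" and "nonscalar_mat A"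
  shows "\<exists>P\<in>carrier_mat n n. invertible_mat P \<and> nonzero_entries (mat_inv P * A * P) \<and>
    (n > 2 \<or> CHAR('a) \<noteq> 2 \<longrightarrow> distinct (diag_mat (mat_inv P * A * P)))"
proof -
  obtain B where B: "similar_mat B A" "nonzero_entries B"
    "n > 2 \<or> CHAR('a) \<noteq> 2 \<Longrightarrow> distinct (diag_mat B)"
    using exists_similar_generic[OF assms] by metis
  obtain P where "P \<in> carrier_mat n n" "invertible_mat P" "mat_inv P * A * P = B"
    using similar_mat_conjugate[OF A B(1)] by blast
  then show ?thesis using B(2,3) by (intro bexI[of _ P]) simp_all
qed

theorem theorem3p1:
  shows "(\<forall>(n::nat) (A :: 'a::field mat).
            n > 2 \<longrightarrow> at_least_elements TYPE('a) (4 * n - 2) \<longrightarrow>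
            A \<in> carrier_mat n n \<longrightarrow> nonscalar_mat A \<longrightarrow>
            (\<exists>P \<in> carrier_mat n n. invertible_mat P \<and>
               nonzero_entries (mat_inv P * A * P) \<and>
               distinct (diag_mat (mat_inv P * A * P)))) \<and>
         (\<forall>A :: 'a::field mat.
            at_least_elements TYPE('a) 6 \<longrightarrow>
            A \<in> carrier_mat 2 2 \<longrightarrow> nonscalar_mat A \<longrightarrow>
            (\<exists>P \<in> carrier_mat 2 2. invertible_mat P \<and>
               nonzero_entries (mat_inv P * A * P)) \<and>
            (CHAR('a) \<noteq> 2 \<longrightarrow>
               (\<exists>P \<in> carrier_mat 2 2. invertible_mat P \<and>
                  nonzero_entries (mat_inv P * A * P) \<and>
                  distinct (diag_mat (mat_inv P * A * P)))))"
proof (intro conjI allI impI)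
  fix n :: nat and A :: "'a mat"
  assume "n > 2" "at_least_elements TYPE('a) (4 * n - 2)" "A \<in> carrier_mat n n" "nonscalar_mat A"
  then show "\<exists>P\<in>carrier_mat n n. invertible_mat P \<and> nonzero_entries (mat_inv P * A * P) \<and>
      distinct (diag_mat (mat_inv P * A * P))"
    using exists_conjugate_generic[of n A] by auto
next
  fix A :: "'a mat"
  assume "at_least_elements TYPE('a) 6" "A \<in> carrier_mat 2 2" "nonscalar_mat A"
  \<comment> \<open>The bound \<open>4 * n - 2\<close> at \<open>n = 2\<close> is exactly the 6 of
    the second part.\<close>
  note generic = exists_conjugate_generic[of 2 A, simplified, OF this]
  show "\<exists>P\<in>carrier_mat 2 2. invertible_mat P \<and> nonzero_entries (mat_inv P * A * P)"
    using generic by blast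
  show "\<exists>P\<in>carrier_mat 2 2. invertible_mat P \<and> nonzero_entries (mat_inv P * A * P) \<and>
      distinct (diag_mat (mat_inv P * A * P))" if "CHAR('a) \<noteq> 2"
    using generic that by blast
qed

end
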